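(* Let $q$ be an odd prime power and $n$ a prime with $(q^n-1)/2$ even, let $Q=\frac{q^n-1}{q-1}$ and $\beta\in\mathbb{F}_q^*$. Write the product of the distinct primes dividing $q^n-1$ as $k p_1\cdots p_s$ with $s\ge0$ and $p_1,\dots,p_s$ distinct primes (not dividing $k$), ordered so that $p_i\mid Q$ for $1\le i\le r$ and $p_i\nmid Q$ for $r<i\le s$. Let $\delta=1-\sum_{i=1}^s\frac1{p_i}$ ($\delta=1$ if $s=0$), $\delta_Q=1-\sum_{i=1}^r\frac1{p_i}$, and let $k_Q$ be the product of the primes dividing $k$ which divide $Q$. Assume $\delta>0$. Then $$\mathcal{N}_\beta(q^n-1)\ \ge\ \delta\,\theta(k)\,q^{\frac{n-1}{2}}\left\{q^{\frac{n-1}{2}}-4\left(\frac{s-1}{\delta}+2\right)W(k)+2\left(\frac{r-1+\delta_Q}{\delta}+1\right)W(k_Q)\right\}.$$ Hence, if $$q^{\frac{n-1}{2}}>4\left(\frac{s-1}{\delta}+2\right)W(k)-2\left(\frac{r-1+\delta_Q}{\delta}+1\right)W(k_Q),$$ then $\mathcal{N}_\beta(q^n-1)>0$.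
   Context: For a divisor $m$ of $q^n-1$, $\xi\in\mathbb{F}_{q^n}^*$ is $m$-free if $\xi=\zeta^d$ with $d\mid m$, $\zeta\in\mathbb{F}_{q^n}^*$ implies $d=1$. $\mathcal{N}_\beta(m)$ is the number of $m$-free $\xi\in\mathbb{F}_{q^n}^*$ with $\mathrm{Tr}(\xi^2)=\beta$, where $\mathrm{Tr}:\mathbb{F}_{q^n}\to\mathbb{F}_q$ is the trace. $\theta(m)=\phi(m)/m$ with $\phi$ Euler's function, and $W(m)=2^{\nu(m)}$ with $\nu(m)$ the number of distinct prime divisors of $m$. *)

theory Defs
  imports Complex_Main "HOL-Library.Cardinality" "HOL-Number_Theory.Number_Theory"
begin

definition is_subfield :: "'a::field set \<Rightarrow> bool" where
  "is_subfield F \<longleftrightarrow> 0 \<in> F \<and> 1 \<in> F \<and>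
     (\<forall>x\<in>F. \<forall>y\<in>F. x - y \<in> F \<and> x * y \<in> F) \<and> (\<forall>x\<in>F. inverse x \<in> F)"

text \<open>The trace of the extension of degree \<open>n\<close> of the field with \<open>q\<close> elements, as the sum of
  the conjugates.  It is used on a field with \<open>q ^ n\<close> elements only; its values then lie in
  the subfield with \<open>q\<close> elements.\<close>

definition field_trace :: "nat \<Rightarrow> nat \<Rightarrow> 'a::field \<Rightarrow> 'a" where
  "field_trace q n x = (\<Sum>i<n. x ^ (q ^ i))"

definition m_free :: "nat \<Rightarrow> 'a::field \<Rightarrow> bool" where
  "m_free m \<xi> \<longleftrightarrow> \<xi> \<noteq> 0 \<and> (\<forall>d \<zeta>. d dvd m \<and> \<zeta> \<noteq> 0 \<and> \<xi> = \<zeta> ^ d \<longrightarrow> d = 1)"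

definition N_free :: "nat \<Rightarrow> nat \<Rightarrow> 'a::{field,finite} \<Rightarrow> nat \<Rightarrow> nat" where
  "N_free q n \<beta> m = card {\<xi>::'a. m_free m \<xi> \<and> field_trace q n (\<xi>\<^sup>2) = \<beta>}"

definition \<theta> :: "nat \<Rightarrow> real" where
  "\<theta> m = real (totient m) / real m"

definition \<nu> :: "nat \<Rightarrow> nat" where
  "\<nu> m = card (prime_factors m)"

definition W :: "nat \<Rightarrow> nat" where
  "W m = 2 ^ \<nu> m"

end

theory Submission imports Defs "HOL-Computational_Algebra.Polynomial" begin

text \<open>
  Write \<open>U \<eta>\<close> for the sum of a multiplicative character \<open>\<eta>\<close> over \<open>{y. Tr y = b}\<close>, \<open>b \<noteq> 0\<close>. Scaling
  by \<open>F\<close> shows that \<open>\<bar>U \<eta>\<bar>\<close> does not depend on \<open>b\<close>, and the second moment of \<open>U \<eta>\<close> over all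
  \<open>b \<in> F\<close> is \<open>q ^ n - q ^ (n - 1)\<close> for \<open>\<eta> \<noteq> 1\<close>; hence \<open>\<bar>U \<eta>\<bar> \<le> X = q powr ((n - 1) / 2)\<close> without
  any Gauss sums. The sum of \<open>\<chi>\<close> over \<open>{x. Tr (x\<^sup>2) = b}\<close> vanishes if \<open>\<chi> (-1) = -1\<close>; otherwise
  \<open>\<chi> = \<eta>\<^sup>2\<close>, and the sum equals \<open>U \<eta> + U (\<lambda> \<eta>)\<close> with the quadratic character \<open>\<lambda>\<close>. So it is at most
  \<open>2 X\<close>, or within \<open>X\<close> of \<open>q ^ (n - 1)\<close> if \<open>\<chi> = 1\<close>.

  Being no \<open>l\<close>-th power is, up to the factor \<open>1 - 1 / l\<close>, the indicator \<open>1 - A\<close> with \<open>A\<close> the average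
  of the characters of order \<open>l\<close>. Adding a prime to the sieve therefore at most doubles the error
  term, and the usual prime sieve yields the bound with \<open>2 ((s - 1) / \<delta> + 2) W k\<close> in place of the
  two correction terms. This is stronger than the claim, because
  \<open>(r - 1 + \<delta>Q) / \<delta> + 1 \<le> (s - 1) / \<delta> + 2\<close> and \<open>W kQ \<le> W k\<close>.
\<close>

section \<open>Cyclicity of the multiplicative group of a finite field\<close>

definition mult_generator :: "'a::field \<Rightarrow> bool" where
  "mult_generator g \<longleftrightarrow> g \<noteq> 0 \<and> (\<forall>x. x \<noteq> 0 \<longrightarrow> (\<exists>i::nat. x = g ^ i))"

text \<open>The field type is repackaged as an explicit ring record, so that the theorem on
  generators of the multiplicative group of a finite field, stated for such records,
  applies.\<close>

lemma mult_generator_exists: "\<exists>g::'a::{field,finite}. mult_generator g"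
proof -
  define R :: "'a ring" where
    "R = \<lparr>carrier = UNIV, monoid.mult = (*), one = 1, ring.zero = 0, add = (+)\<rparr>"
  interpret R: Ring.field R
  proof -
    have "cring R"
      by (intro cringI abelian_groupI comm_monoidI)
         (auto simp: R_def algebra_simps intro: exI[of _ "- x" for x])
    moreover have "\<exists>y. x * y = 1" if "x \<noteq> 0" for x :: 'a
      by (rule exI[of _ "inverse x"]) (simp add: that)
    ultimately show "Ring.field R"
      by (intro cring.cring_fieldI2) (auto simp: R_def)
  qed
  have pow: "x [^]\<^bsub>R\<^esub> (i::nat) = x ^ i" for x i
    by (induction i) (simp_all add: R_def mult.commute)
  have "finite (carrier R)" by (simp add: R_def)
  from R.finite_field_mult_group_has_gen[OF this] obtain a
    where "a \<in> carrier (mult_of R)" "carrier (mult_of R) = {a [^]\<^bsub>R\<^esub> i |i::nat. i \<in> UNIV}"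
    by (auto simp: nat_pow_mult_of)
  hence "mult_generator a"
    unfolding mult_generator_def pow by (auto simp: R_def)
  thus ?thesis ..
qed

text \<open>Multiplication by \<open>x\<close> permutes the nonzero elements, so their product,
  itself nonzero, absorbs the factor \<open>x ^ (CARD('a) - 1)\<close>.\<close>

lemma finite_field_power_card_minus_1:
  fixes x :: "'a::{field,finite}"
  assumes "x \<noteq> 0"
  shows "x ^ (CARD('a) - 1) = 1"
proof -
  have "(\<Prod>y\<in>UNIV-{0}. y) = (\<Prod>y\<in>UNIV-{0}. x * y)"
    by (rule prod.reindex_bij_witness[of _ "\<lambda>y. x * y" "\<lambda>y. y / x"]) (use assms in auto)
  also have "\<dots> = x ^ (CARD('a) - 1) * (\<Prod>y\<in>UNIV-{0}. y)"
    by (simp add: prod.distrib)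
  finally show ?thesis by simp
qed

lemma finite_field_power_card:
  fixes x :: "'a::{field,finite}"
  shows "x ^ CARD('a) = x"
proof (cases "x = 0")
  case False
  have "x ^ CARD('a) = x * x ^ (CARD('a) - 1)"
    by (metis power_eq_if zero_less_card_finite less_numeral_extra(3))
  thus ?thesis by (simp only: finite_field_power_card_minus_1[OF False] mult_1_right)
qed simp

lemma power_mod_period:
  fixes g :: "'a::monoid_mult"
  assumes "g ^ N = 1"
  shows "g ^ (i mod N) = g ^ i"
proof -
  have "g ^ i = g ^ (N * (i div N) + i mod N)" by simp
  also have "\<dots> = g ^ (i mod N)" by (simp only: power_add power_mult assms) simp
  finally show ?thesis ..
qed

text \<open>The powers with exponent below \<open>CARD('a) - 1\<close> already cover all
  \<open>CARD('a) - 1\<close> nonzero elements; by counting, no two of them coincide.\<close>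

lemma mult_generator_power_eq_iff:
  fixes g :: "'a::{field,finite}"
  assumes "mult_generator g"
  shows "g ^ i = g ^ j \<longleftrightarrow> i mod (CARD('a) - 1) = j mod (CARD('a) - 1)"
proof -
  define N where "N = CARD('a) - 1"
  have "CARD('a) > 1"
    using card_mono[of "UNIV::'a set" "{0,1}"] by auto
  hence N: "N > 0" by (simp add: N_def)
  have g: "g ^ N = 1" "g \<noteq> 0"
    using assms finite_field_power_card_minus_1 by (auto simp: mult_generator_def N_def)
  have "UNIV - {0} \<subseteq> (\<lambda>i. g ^ i) ` {..<N}"
  proof
    fix x :: 'a assume "x \<in> UNIV - {0}"
    then obtain i where "x = g ^ i" using assms by (auto simp: mult_generator_def)
    hence "x = g ^ (i mod N)" by (simp add: power_mod_period g)
    thus "x \<in> (\<lambda>i. g ^ i) ` {..<N}" using N by auto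
  qed
  hence "card (UNIV - {0::'a}) \<le> card ((\<lambda>i. g ^ i) ` {..<N})"
    by (intro card_mono) auto
  moreover have "card (UNIV - {0::'a}) = N" by (simp add: N_def card_Diff_singleton)
  moreover have "card ((\<lambda>i. g ^ i) ` {..<N}) \<le> N"
    using card_image_le[of "{..<N}" "\<lambda>i. g ^ i"] by simp
  ultimately have "inj_on (\<lambda>i. g ^ i) {..<N}"
    by (intro eq_card_imp_inj_on) auto
  hence "g ^ (i mod N) = g ^ (j mod N) \<longleftrightarrow> i mod N = j mod N"
    using N by (auto simp: inj_on_def)
  thus ?thesis unfolding N_def[symmetric] by (simp add: power_mod_period g)
qed

section \<open>Multiplicative characters\<close>

text \<open>Every character vanishes at 0, so the trivial one is
  \<open>of_bool (x \<noteq> 0)\<close> and not the constant 1; hence the condition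
  \<open>j > 0\<close> in \<open>mult_char_pow\<close>.\<close>

definition mult_char :: "('a::field \<Rightarrow> complex) \<Rightarrow> bool" where
  "mult_char \<chi> \<longleftrightarrow> \<chi> 0 = 0 \<and> \<chi> 1 = 1 \<and> (\<forall>x y. \<chi> (x * y) = \<chi> x * \<chi> y)"

definition nontrivial :: "('a::field \<Rightarrow> complex) \<Rightarrow> bool" where
  "nontrivial \<chi> \<longleftrightarrow> (\<exists>x. x \<noteq> 0 \<and> \<chi> x \<noteq> 1)"

lemma mult_charD:
  assumes "mult_char \<chi>"
  shows "\<chi> 0 = 0" "\<chi> 1 = 1" "\<chi> (x * y) = \<chi> x * \<chi> y"
  using assms by (auto simp: mult_char_def)

lemma mult_char_power: "mult_char \<chi> \<Longrightarrow> \<chi> (x ^ k) = \<chi> x ^ k"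
  by (induction k) (simp_all add: mult_charD)

lemma mult_char_mult: "mult_char \<chi> \<Longrightarrow> mult_char \<eta> \<Longrightarrow> mult_char (\<lambda>x. \<chi> x * \<eta> x)"
  by (simp add: mult_char_def)

lemma mult_char_pow: "mult_char \<chi> \<Longrightarrow> j > 0 \<Longrightarrow> mult_char (\<lambda>x. \<chi> x ^ j)"
  by (simp add: mult_char_def power_mult_distrib)

lemma mult_char_trivial: "mult_char (\<lambda>x. of_bool (x \<noteq> 0))"
  by (simp add: mult_char_def)

lemma norm_mult_char:
  fixes \<chi> :: "'a::{field,finite} \<Rightarrow> complex"
  assumes "mult_char \<chi>" "x \<noteq> 0"
  shows "norm (\<chi> x) = 1"
proof -
  have "CARD('a) > 1"
    using card_mono[of "UNIV::'a set" "{0,1}"] by auto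
  moreover have "\<chi> x ^ (CARD('a) - 1) = 1"
    by (simp only: mult_char_power[OF assms(1), symmetric] mult_charD[OF assms(1)]
        finite_field_power_card_minus_1[OF assms(2)])
  hence "norm (\<chi> x) ^ (CARD('a) - 1) = 1 ^ (CARD('a) - 1)"
    by (simp only: norm_power[symmetric] norm_one power_one)
  ultimately show ?thesis
    by (auto intro: power_eq_imp_eq_base[of _ "CARD('a) - 1" 1])
qed

lemma mult_char_mult_cnj:
  fixes \<chi> :: "'a::{field,finite} \<Rightarrow> complex"
  assumes "mult_char \<chi>" "x \<noteq> 0"
  shows "\<chi> x * cnj (\<chi> x) = 1"
  using norm_mult_char[OF assms] by (simp add: complex_norm_square[symmetric])

text \<open>Replacing \<open>x\<close> by \<open>c * x\<close> permutes the field and multiplies the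
  sum by \<open>\<chi> c\<close>, where \<open>c\<close> is chosen with
  \<open>\<chi> c \<noteq> 1\<close>.\<close>

lemma sum_mult_char_nontrivial:
  fixes \<chi> :: "'a::{field,finite} \<Rightarrow> complex"
  assumes "mult_char \<chi>" "nontrivial \<chi>"
  shows "(\<Sum>x\<in>UNIV. \<chi> x) = 0"
proof -
  obtain c where c: "c \<noteq> 0" "\<chi> c \<noteq> 1" using assms by (auto simp: nontrivial_def)
  have "(\<Sum>x\<in>UNIV. \<chi> x) = (\<Sum>x\<in>UNIV. \<chi> (c * x))"
    by (rule sum.reindex_bij_witness[of _ "\<lambda>y. c * y" "\<lambda>y. y / c"]) (use c in auto)
  also have "\<dots> = \<chi> c * (\<Sum>x\<in>UNIV. \<chi> x)"
    by (simp add: mult_charD[OF assms(1)] sum_distrib_left)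
  finally show ?thesis using c by simp
qed

text \<open>The discrete logarithm \<open>ind\<close> to base \<open>g\<close> is determined only
  modulo \<open>CARD('a) - 1\<close>; the condition on \<open>w\<close> makes
  \<open>w ^ ind x\<close> independent of the chosen exponent.\<close>

lemma mult_char_exists:
  fixes g :: "'a::{field,finite}"
  assumes g: "mult_generator g" and w: "w ^ (CARD('a) - 1) = 1"
  shows "\<exists>\<chi>. mult_char \<chi> \<and> \<chi> g = w"
proof -
  define ind where "ind = (\<lambda>x. SOME i::nat. x = g ^ i)"
  define \<chi> where "\<chi> = (\<lambda>x. if x = 0 then 0 else w ^ ind x)"
  have g0: "g \<noteq> 0" using g by (simp add: mult_generator_def)
  have ind: "x = g ^ ind x" if "x \<noteq> 0" for x
    unfolding ind_def by (rule someI_ex) (use g that in \<open>auto simp: mult_generator_def\<close>)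
  have val: "\<chi> (g ^ i) = w ^ i" for i
  proof -
    have "g ^ i = g ^ ind (g ^ i)" by (rule ind) (simp add: g0)
    hence "i mod (CARD('a) - 1) = ind (g ^ i) mod (CARD('a) - 1)"
      using mult_generator_power_eq_iff[OF g] by blast
    hence "w ^ i = w ^ ind (g ^ i)" by (metis power_mod_period w)
    thus ?thesis by (simp add: \<chi>_def g0)
  qed
  have "\<chi> (x * y) = \<chi> x * \<chi> y" for x y
  proof (cases "x = 0 \<or> y = 0")
    case False
    then obtain i j where ij: "x = g ^ i" "y = g ^ j"
      using g unfolding mult_generator_def by blast
    hence "x * y = g ^ (i + j)" by (simp add: power_add)
    thus ?thesis using ij by (metis val power_add)
  qed (auto simp: \<chi>_def)
  moreover have "\<chi> 1 = 1" using val[of 0] by simp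
  moreover have "\<chi> g = w" using val[of 1] by simp
  moreover have "\<chi> 0 = 0" by (simp add: \<chi>_def)
  ultimately show ?thesis by (auto simp: mult_char_def)
qed

lemma mult_char_eqI:
  assumes "mult_generator g" "mult_char \<chi>" "mult_char \<eta>" "\<chi> g = \<eta> g"
  shows "\<chi> x = \<eta> x"
proof (cases "x = 0")
  case False
  then obtain i where "x = g ^ i" using assms unfolding mult_generator_def by blast
  thus ?thesis using assms by (simp add: mult_char_power)
qed (use assms in \<open>simp add: mult_charD\<close>)

lemma nontrivial_iff_generator:
  assumes "mult_generator g" "mult_char \<chi>"
  shows "nontrivial \<chi> \<longleftrightarrow> \<chi> g \<noteq> 1"
proof
  assume "nontrivial \<chi>"
  then obtain x where x: "x \<noteq> 0" "\<chi> x \<noteq> 1" by (auto simp: nontrivial_def)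
  then obtain i where "x = g ^ i" using assms unfolding mult_generator_def by blast
  with x assms show "\<chi> g \<noteq> 1" by (auto simp: mult_char_power)
qed (use assms in \<open>auto simp: nontrivial_def mult_generator_def\<close>)

section \<open>The subfield with \<open>q\<close> elements and the trace\<close>

locale finite_extension =
  fixes F :: "'a::{field,finite} set" and q n :: nat
  assumes primepow_q: "primepow q" and n_pos: "n > 0"
    and card_UNIV: "CARD('a) = q ^ n" and subfield: "is_subfield F" and card_F: "card F = q"
begin

abbreviation Tr :: "'a \<Rightarrow> 'a" where "Tr \<equiv> field_trace q n"

lemma q_gt_1: "q > 1"
  using primepow_gt_Suc_0[OF primepow_q] by simp

text \<open>The characteristic divides the number of elements, a power of the prime underlying
  \<open>q\<close>. This makes the \<open>q\<close>-th power map additive.\<close>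

lemma q_power_CHAR: "\<exists>e. q = CHAR('a) ^ e" and prime_CHAR: "prime CHAR('a)"
proof -
  show pr: "prime CHAR('a)"
    by (intro prime_CHAR_semidom finite_imp_CHAR_pos) simp
  obtain p e where pe: "prime p" "q = p ^ e" using primepow_q by (auto simp: primepow_def)
  have "CHAR('a) dvd p ^ (e * n)"
    using CHAR_dvd_CARD[where ?'a = 'a] by (simp add: card_UNIV pe power_mult)
  hence "CHAR('a) = p"
    using pr pe by (metis prime_dvd_power primes_dvd_imp_eq)
  thus "\<exists>e. q = CHAR('a) ^ e" using pe by auto
qed

lemma frobenius_add: "(x + y) ^ (q ^ i) = x ^ (q ^ i) + (y::'a) ^ (q ^ i)"
proof -
  obtain e where "q = CHAR('a) ^ e" using q_power_CHAR by blast
  thus ?thesis using freshmans_dream'[OF prime_CHAR, of "q ^ i" "e * i"] by (simp add: power_mult)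
qed

lemma frobenius_sum: "sum f A ^ q = (\<Sum>i\<in>A. (f i :: 'a) ^ q)"
proof -
  obtain e where "q = CHAR('a) ^ e" using q_power_CHAR by blast
  thus ?thesis by (intro freshmans_dream_sum'[OF prime_CHAR])
qed

lemma subfield_closed:
  "0 \<in> F" "1 \<in> F" "x \<in> F \<Longrightarrow> y \<in> F \<Longrightarrow> x * y \<in> F" "x \<in> F \<Longrightarrow> inverse x \<in> F"
  using subfield by (auto simp: is_subfield_def)

text \<open>One inclusion repeats the product argument inside \<open>F\<close>. The right-hand side
  is the root set of a nonzero polynomial of degree at most \<open>q\<close>, so counting gives
  equality.\<close>

lemma subfield_eq: "F = {x. x ^ q = x}"
proof (rule card_subset_eq)
  have "x ^ q = x" if x: "x \<in> F" for x
  proof (cases "x = 0")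
    case False
    have "(\<Prod>y\<in>F-{0}. y) = (\<Prod>y\<in>F-{0}. x * y)"
      by (rule prod.reindex_bij_witness[of _ "\<lambda>y. x * y" "\<lambda>y. inverse x * y"])
         (use False x in \<open>auto intro!: subfield_closed\<close>)
    also have "\<dots> = x ^ (q - 1) * (\<Prod>y\<in>F-{0}. y)"
      by (simp add: prod.distrib card_Diff_singleton subfield_closed card_F)
    finally have "x ^ (q - 1) = 1" by simp
    thus ?thesis using q_gt_1 by (metis power_eq_if mult.right_neutral not_one_less_zero)
  qed (use q_gt_1 in simp)
  thus sub: "F \<subseteq> {x. x ^ q = x}" by auto
  let ?p = "monom 1 q - monom 1 1 :: 'a poly"
  have "coeff ?p q = 1" using q_gt_1 by simp
  hence "?p \<noteq> 0" by (metis coeff_0 zero_neq_one)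
  moreover have "degree ?p \<le> q" using q_gt_1 by (intro degree_diff_le) (auto simp: degree_monom_eq)
  moreover have "{x. poly ?p x = 0} = {x. x ^ q = x}" by (auto simp: poly_monom)
  ultimately have "card {x::'a. x ^ q = x} \<le> q"
    using card_poly_roots_bound[of ?p] by auto
  with sub show "card F = card {x::'a. x ^ q = x}"
    using card_mono[OF _ sub] by (simp add: card_F)
qed simp

lemma trace_add: "Tr (x + y) = Tr x + Tr y"
  by (simp add: field_trace_def frobenius_add sum.distrib)

lemma trace_scale:
  assumes "c \<in> F"
  shows "Tr (c * x) = c * Tr x"
proof -
  have "c ^ (q ^ i) = c" for i
    using assms by (induction i) (auto simp: subfield_eq power_mult)
  thus ?thesis by (simp add: field_trace_def power_mult_distrib sum_distrib_left)
qed

text \<open>Raising to the \<open>q\<close>-th power shifts the conjugates cyclically, because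
  \<open>x ^ (q ^ n) = x\<close>; the trace is therefore fixed by it.\<close>

lemma trace_in_F: "Tr x \<in> F"
proof -
  obtain m where m: "n = Suc m" using n_pos by (cases n) auto
  have "Tr x ^ q = (\<Sum>i<n. x ^ (q ^ Suc i))"
    by (simp add: field_trace_def frobenius_sum power_mult[symmetric] mult.commute)
  also have "\<dots> = (\<Sum>i<m. x ^ (q ^ Suc i)) + x ^ (q ^ n)" by (simp add: m)
  also have "x ^ (q ^ n) = x ^ (q ^ 0)" using finite_field_power_card[of x] by (simp add: card_UNIV)
  also have "(\<Sum>i<m. x ^ (q ^ Suc i)) + x ^ (q ^ 0) = Tr x"
    unfolding field_trace_def m sum.lessThan_Suc_shift by (simp add: add.commute)
  finally show ?thesis by (simp add: subfield_eq)
qed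

text \<open>Each fibre is the zero set of a polynomial of degree \<open>q ^ (n - 1)\<close>; as the \<open>q\<close> fibres
  exhaust \<open>q ^ n\<close> elements, every one of them is as large as possible.\<close>

lemma card_trace_fibre:
  assumes "b \<in> F"
  shows "card {x. Tr x = b} = q ^ (n - 1)"
proof -
  have le: "card {x. Tr x = c} \<le> q ^ (n - 1)" for c
  proof -
    let ?p = "(\<Sum>i<n. monom 1 (q ^ i)) - [:c:] :: 'a poly"
    have "coeff ?p (q ^ (n - 1)) = (\<Sum>i<n. if i = n - 1 then 1 else 0)"
    proof -
      have "coeff [:c:] (q ^ (n - 1)) = 0"
        using q_gt_1 by (intro coeff_eq_0) auto
      thus ?thesis using q_gt_1 by (auto simp: coeff_sum intro!: sum.cong)
    qed
    also have "\<dots> = 1" using n_pos by simp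
    finally have "?p \<noteq> 0" by (metis coeff_0 zero_neq_one)
    moreover have "degree ?p \<le> q ^ (n - 1)"
      using q_gt_1
      by (intro degree_diff_le degree_sum_le) (auto simp: degree_monom_eq intro!: power_increasing)
    moreover have "{x. poly ?p x = 0} = {x. Tr x = c}"
      by (auto simp: poly_sum poly_monom field_trace_def)
    ultimately show ?thesis using card_poly_roots_bound[of ?p] by auto
  qed
  have fin: "finite F" by simp
  have "UNIV = (\<Union>c\<in>F. {x. Tr x = c})" using trace_in_F by auto
  hence "CARD('a) = card (\<Union>c\<in>F. {x. Tr x = c})" by simp
  also have "\<dots> = (\<Sum>c\<in>F. card {x. Tr x = c})"
    by (intro card_UN_disjoint) auto
  finally have tot: "(\<Sum>c\<in>F. card {x. Tr x = c}) = q * q ^ (n - 1)"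
    using n_pos by (simp add: card_UNIV power_eq_if)
  show ?thesis
  proof (rule ccontr)
    assume "\<not> ?thesis"
    with le[of b] have "card {x. Tr x = b} < q ^ (n - 1)" by simp
    hence "(\<Sum>c\<in>F. card {x. Tr x = c}) < (\<Sum>c\<in>F. q ^ (n - 1))"
      using assms le by (intro sum_strict_mono_ex1) auto
    thus False using tot by (simp add: card_F)
  qed
qed

end

section \<open>Character sums over the fibres of the trace\<close>

context finite_extension
begin

definition fibre_sum :: "'a \<Rightarrow> ('a \<Rightarrow> complex) \<Rightarrow> complex" where
  "fibre_sum b \<chi> = (\<Sum>x | Tr x = b. \<chi> x)"

lemma fibre_sum_scale:
  assumes "mult_char \<chi>" "c \<in> F" "c \<noteq> 0"
  shows "fibre_sum (c * b) \<chi> = \<chi> c * fibre_sum b \<chi>"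
proof -
  have "fibre_sum (c * b) \<chi> = (\<Sum>x | Tr x = b. \<chi> (c * x))"
    unfolding fibre_sum_def
  proof (rule sum.reindex_bij_witness[of _ "\<lambda>x. c * x" "\<lambda>x. inverse c * x"])
    fix x assume "x \<in> {x. Tr x = c * b}"
    thus "inverse c * x \<in> {x. Tr x = b}"
      using assms by (auto simp: trace_scale subfield_closed)
  qed (use assms in \<open>auto simp: trace_scale mult.assoc[symmetric]\<close>)
  thus ?thesis by (simp add: mult_charD[OF assms(1)] fibre_sum_def sum_distrib_left)
qed

lemma trace_0: "Tr 0 = 0"
  using trace_scale[of 0 0] by (simp add: subfield_closed)

lemma trace_diff: "Tr (x - y) = Tr x - Tr y"
  using trace_add[of "x - y" y] by simp

text \<open>With \<open>t - 1\<close> for \<open>t\<close>, this is the multiplicity of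
  \<open>\<chi> t\<close> in the second moment computed next. For \<open>t \<noteq> 0\<close>,
  multiplication by \<open>t\<close> carries the solutions to the kernel of the trace.\<close>

lemma card_trace_mult_kernel:
  "card {y. y \<noteq> 0 \<and> Tr (t * y) = 0} = (if t = 0 then q ^ n - 1 else q ^ (n - 1) - 1)"
proof -
  have "{y. y \<noteq> 0 \<and> Tr (t * y) = 0} = {y. Tr (t * y) = 0} - {0}" by auto
  moreover have "card ({y. Tr (t * y) = 0} - {0}) = card {y. Tr (t * y) = 0} - 1"
    by (subst card_Diff_singleton) (auto simp: trace_0)
  moreover have "card {y. Tr (t * y) = 0} = (if t = 0 then q ^ n else q ^ (n - 1))"
  proof (cases "t = 0")
    case False
    have "bij_betw (\<lambda>y. t * y) {y. Tr (t * y) = 0} {x. Tr x = 0}"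
      by (rule bij_betw_byWitness[of _ "\<lambda>y. y / t"]) (use False in auto)
    thus ?thesis using False card_trace_fibre[of 0] subfield_closed
      by (simp add: bij_betw_same_card)
  qed (simp add: trace_0 card_UNIV)
  ultimately show ?thesis by simp
qed

text \<open>The squares expand into pairs \<open>x\<close>, \<open>y\<close> of equal trace. With
  \<open>x = t * y\<close> and \<open>y \<noteq> 0\<close> such a pair contributes
  \<open>\<chi> t\<close>, and the number of admissible \<open>y\<close> is the same for every
  \<open>t \<noteq> 1\<close>. Orthogonality cancels this common part and leaves the surplus at
  \<open>t = 1\<close>.\<close>

lemma sum_norm_fibre_sum:
  assumes \<chi>: "mult_char \<chi>" "nontrivial \<chi>"
  shows "(\<Sum>b\<in>F. (norm (fibre_sum b \<chi>))\<^sup>2) = real q ^ n - real q ^ (n - 1)"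
proof -
  define c where "c = (\<lambda>t::'a. card {y. y \<noteq> 0 \<and> Tr ((t - 1) * y) = 0})"
  have "complex_of_real (\<Sum>b\<in>F. (norm (fibre_sum b \<chi>))\<^sup>2)
      = (\<Sum>b\<in>F. fibre_sum b \<chi> * cnj (fibre_sum b \<chi>))"
    by (simp only: of_real_sum complex_norm_square)
  also have "\<dots> = (\<Sum>b\<in>F. \<Sum>y | Tr y = b. \<Sum>x | Tr x = b. \<chi> x * cnj (\<chi> y))"
    by (simp add: fibre_sum_def sum_product) (subst sum.swap, rule refl)
  \<comment> \<open>With \<open>Tr y\<close> in place of \<open>b\<close> the inner sum no longer
    mentions \<open>b\<close>, so the fibres recombine to one sum over all \<open>y\<close>.\<close>
  also have "\<dots> = (\<Sum>b\<in>F. \<Sum>y | y \<in> UNIV \<and> Tr y = b. \<Sum>x | Tr x = Tr y. \<chi> x * cnj (\<chi> y))"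
    by (intro sum.cong refl) auto
  also have "\<dots> = (\<Sum>y\<in>UNIV. \<Sum>x | Tr x = Tr y. \<chi> x * cnj (\<chi> y))"
    by (rule sum.group) (auto simp: trace_in_F)
  also have "\<dots> = (\<Sum>y\<in>UNIV. \<Sum>t\<in>UNIV. if y \<noteq> 0 \<and> Tr ((t - 1) * y) = 0 then \<chi> t else 0)"
  proof (rule sum.cong[OF refl])
    fix y :: 'a
    show "(\<Sum>x | Tr x = Tr y. \<chi> x * cnj (\<chi> y))
        = (\<Sum>t\<in>UNIV. if y \<noteq> 0 \<and> Tr ((t - 1) * y) = 0 then \<chi> t else 0)"
    proof (cases "y = 0")
      case False
      have "(\<Sum>x | Tr x = Tr y. \<chi> x * cnj (\<chi> y)) = (\<Sum>t | Tr ((t - 1) * y) = 0. \<chi> t)"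
      proof (rule sum.reindex_bij_witness[of _ "\<lambda>t. t * y" "\<lambda>x. x / y"])
        fix x
        show "\<chi> (x / y) = \<chi> x * cnj (\<chi> y)"
        proof -
          have "\<chi> x * cnj (\<chi> y) = \<chi> (x / y * y) * cnj (\<chi> y)" using False by simp
          also have "\<dots> = \<chi> (x / y) * (\<chi> y * cnj (\<chi> y))"
            by (simp only: mult_charD[OF \<chi>(1)] mult.assoc)
          finally show ?thesis by (simp add: mult_char_mult_cnj[OF \<chi>(1) False])
        qed
      qed (use False in \<open>auto simp: trace_diff algebra_simps\<close>)
      thus ?thesis using False by (simp add: sum.If_cases)
    qed (simp add: mult_charD[OF \<chi>(1)])
  qed
  also have "\<dots> = (\<Sum>t\<in>UNIV. \<Sum>y\<in>UNIV. if y \<noteq> 0 \<and> Tr ((t - 1) * y) = 0 then \<chi> t else 0)"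
    by (rule sum.swap)
  also have "\<dots> = (\<Sum>t\<in>UNIV. of_nat (c t) * \<chi> t)"
    by (simp add: sum.If_cases c_def)
  \<comment> \<open>The coefficient \<open>q ^ n - 1\<close> at \<open>t = 1\<close> is split into
    the common value \<open>q ^ (n - 1) - 1\<close> and the rest.\<close>
  also have "\<dots> = (\<Sum>t\<in>UNIV. (of_nat q ^ (n - 1) - 1) * \<chi> t
                      + (if t = 1 then of_nat q ^ n - of_nat q ^ (n - 1) else 0))"
    using q_gt_1
    by (intro sum.cong refl)
       (auto simp: c_def card_trace_mult_kernel of_nat_diff mult_charD[OF \<chi>(1)])
  also have "\<dots> = of_nat q ^ n - of_nat q ^ (n - 1)"
    by (simp add: sum.distrib sum_distrib_left[symmetric] sum_mult_char_nontrivial[OF \<chi>])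
  finally have "complex_of_real (\<Sum>b\<in>F. (norm (fibre_sum b \<chi>))\<^sup>2)
      = complex_of_real (real q ^ n - real q ^ (n - 1))" by simp
  thus ?thesis by (simp only: of_real_eq_iff)
qed

text \<open>A square root makes \<open>X_sq\<close> immediate; the form with \<open>powr\<close> is
  recovered in the final theorem.\<close>

definition X :: real where "X = sqrt (real q ^ (n - 1))"

lemma X_nonneg: "X \<ge> 0" and X_sq: "X\<^sup>2 = real q ^ (n - 1)"
  by (simp_all add: X_def)

text \<open>By \<open>fibre_sum_scale\<close> the \<open>q - 1\<close> fibres over nonzero elements
  of \<open>F\<close> give the same norm. Dropping the fibre over 0 from the second moment, which is
  \<open>(q - 1) * q ^ (n - 1)\<close>, bounds \<open>q - 1\<close> times the square of this
  norm.\<close>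

lemma norm_fibre_sum_le:
  assumes \<chi>: "mult_char \<chi>" "nontrivial \<chi>" and b: "b \<in> F" "b \<noteq> 0"
  shows "norm (fibre_sum b \<chi>) \<le> X"
proof -
  have eq: "norm (fibre_sum c \<chi>) = norm (fibre_sum b \<chi>)" if c: "c \<in> F - {0}" for c
  proof -
    have "c * inverse b \<in> F" using b c by (simp add: subfield_closed)
    moreover have "c * inverse b * b = c" "c * inverse b \<noteq> 0" using b c by auto
    ultimately have "fibre_sum c \<chi> = \<chi> (c * inverse b) * fibre_sum b \<chi>"
      using fibre_sum_scale[OF \<chi>(1), of "c * inverse b" b] by metis
    thus ?thesis
      by (simp only: norm_mult norm_mult_char[OF \<chi>(1) \<open>c * inverse b \<noteq> 0\<close>] mult_1)
  qed
  have "(real q - 1) * (norm (fibre_sum b \<chi>))\<^sup>2 = (\<Sum>c\<in>F-{0}. (norm (fibre_sum c \<chi>))\<^sup>2)"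
    using q_gt_1 by (simp add: eq card_Diff_singleton subfield_closed card_F of_nat_diff)
  also have "\<dots> \<le> (\<Sum>c\<in>F. (norm (fibre_sum c \<chi>))\<^sup>2)"
    by (intro sum_mono2) auto
  also have "\<dots> = (real q - 1) * real q ^ (n - 1)"
    unfolding sum_norm_fibre_sum[OF \<chi>] using n_pos by (cases n) (simp_all add: algebra_simps)
  finally have "(norm (fibre_sum b \<chi>))\<^sup>2 \<le> real q ^ (n - 1)" using q_gt_1 by simp
  thus ?thesis unfolding X_def by (rule real_le_rsqrt)
qed

lemma fibre_sum_trivial:
  assumes "b \<in> F" "b \<noteq> 0"
  shows "fibre_sum b (\<lambda>x. of_bool (x \<noteq> 0)) = of_nat q ^ (n - 1)"
proof -
  have "fibre_sum b (\<lambda>x. of_bool (x \<noteq> 0)) = (\<Sum>x | Tr x = b. 1)"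
    unfolding fibre_sum_def using assms by (intro sum.cong) (auto simp: trace_0)
  thus ?thesis by (simp add: card_trace_fibre assms)
qed

section \<open>Character sums over the solutions of \<open>Tr (x\<^sup>2) = b\<close>\<close>

definition square_sum :: "'a \<Rightarrow> ('a \<Rightarrow> complex) \<Rightarrow> complex" where
  "square_sum b \<chi> = (\<Sum>x | Tr (x\<^sup>2) = b. \<chi> x)"

end

text \<open>Even powers of \<open>g\<close> have two roots, distinct because
  \<open>1 \<noteq> -1\<close>. Nonzero squares have \<open>lam\<close> value 1, so odd powers, with
  value -1, have no root.\<close>

lemma card_square_roots:
  fixes g :: "'a::{field,finite}"
  assumes g: "mult_generator g" and lam: "mult_char lam" "lam g = -1"
    and char: "(1::'a) \<noteq> -1" and y: "y \<noteq> 0"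
  shows "complex_of_nat (card {x. x\<^sup>2 = y}) = 1 + lam y"
proof -
  obtain i where i: "y = g ^ i" using g y by (auto simp: mult_generator_def)
  have ly: "lam y = (-1) ^ i" by (simp add: i mult_char_power lam)
  show ?thesis
  proof (cases "even i")
    case True
    then obtain j where j: "i = 2 * j" by auto
    have g0: "g \<noteq> 0" using g by (simp add: mult_generator_def)
    have "{x. x\<^sup>2 = y} = {x. x\<^sup>2 = (g ^ j)\<^sup>2}" by (simp add: i j power_mult[symmetric] mult.commute)
    also have "\<dots> = {g ^ j, - (g ^ j)}" by (auto simp: power2_eq_iff)
    finally have roots: "{x. x\<^sup>2 = y} = {g ^ j, - (g ^ j)}" .
    have "g ^ j \<noteq> - (g ^ j)"
    proof
      assume "g ^ j = - (g ^ j)"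
      hence "g ^ j * 1 = g ^ j * (-1)" by simp
      thus False using g0 char by (metis mult_left_cancel power_not_zero)
    qed
    hence "card {x. x\<^sup>2 = y} = 2" by (simp add: roots)
    thus ?thesis using True by (simp add: ly)
  next
    case False
    have "{x. x\<^sup>2 = y} = {}"
    proof safe
      fix x assume x: "y = x\<^sup>2"
      hence "x \<noteq> 0" using y by auto
      then obtain j where "x = g ^ j" using g by (auto simp: mult_generator_def)
      hence "lam y = ((-1) ^ j)\<^sup>2" by (simp add: x mult_char_power lam)
      also have "\<dots> = 1" by (simp add: power_mult[symmetric])
      finally show "x \<in> {}" using False by (simp add: ly)
    qed
    thus ?thesis using False by (simp add: ly)
  qed
qed

context finite_extension
begin

text \<open>Sorting the \<open>x\<close> by their square \<open>y\<close> gives a sum over a trace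
  fibre, which the number of roots \<open>1 + lam y\<close> splits in two.\<close>

lemma square_sum_of_square:
  assumes g: "mult_generator g" and lam: "mult_char lam" "lam g = -1"
    and char: "(1::'a) \<noteq> -1" and \<eta>: "mult_char \<eta>"
  shows "square_sum b (\<lambda>x. (\<eta> x)\<^sup>2) = fibre_sum b \<eta> + fibre_sum b (\<lambda>x. lam x * \<eta> x)"
proof -
  have "square_sum b (\<lambda>x. (\<eta> x)\<^sup>2) = (\<Sum>x | Tr (x\<^sup>2) = b. \<eta> (x\<^sup>2))"
    by (simp add: square_sum_def mult_char_power \<eta>)
  also have "\<dots> = (\<Sum>y | Tr y = b. \<Sum>x | x \<in> {x. Tr (x\<^sup>2) = b} \<and> x\<^sup>2 = y. \<eta> (x\<^sup>2))"
    by (rule sum.group[symmetric]) auto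
  also have "\<dots> = (\<Sum>y | Tr y = b. \<Sum>x | x\<^sup>2 = y. \<eta> y)"
    by (intro sum.cong refl) auto
  also have "\<dots> = (\<Sum>y | Tr y = b. of_nat (card {x. x\<^sup>2 = y}) * \<eta> y)" by simp
  also have "\<dots> = (\<Sum>y | Tr y = b. \<eta> y + lam y * \<eta> y)"
  proof (intro sum.cong refl)
    fix y show "of_nat (card {x. x\<^sup>2 = y}) * \<eta> y = \<eta> y + lam y * \<eta> y"
      using card_square_roots[OF g lam char, of y]
      by (cases "y = 0") (auto simp: mult_charD[OF \<eta>] algebra_simps)
  qed
  finally show ?thesis by (simp add: fibre_sum_def sum.distrib)
qed

end

locale odd_finite_extension = finite_extension +
  assumes odd_q: "odd q"
begin

lemma one_neq_minus_one: "(1::'a) \<noteq> -1"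
proof
  assume "(1::'a) = -1"
  hence "of_nat 2 = (0::'a)" by (simp add: eq_neg_iff_add_eq_0)
  hence "CHAR('a) dvd 2" by (simp only: of_nat_eq_0_iff_char_dvd)
  hence "CHAR('a) = 2" using prime_CHAR by (metis primes_dvd_imp_eq two_is_prime_nat)
  moreover obtain e where "q = CHAR('a) ^ e" using q_power_CHAR by blast
  ultimately show False using odd_q q_gt_1 by (cases e) auto
qed

lemma even_card_minus_1: "even (CARD('a) - 1)"
  using odd_q by (simp add: card_UNIV)

lemma quadratic_char_exists:
  assumes "mult_generator g"
  shows "\<exists>lam. mult_char lam \<and> lam (g::'a) = -1"
  by (rule mult_char_exists[OF assms]) (use even_card_minus_1 in simp)

text \<open>With \<open>N = 2 * m\<close>, the element -1 is \<open>g ^ m\<close>, so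
  \<open>\<chi> g ^ m = 1\<close>. Hence a complex square root of \<open>\<chi> g\<close> is an
  \<open>N\<close>-th root of unity and so the value at \<open>g\<close> of some character.\<close>

lemma mult_char_sqrt:
  assumes g: "mult_generator (g::'a)" and \<chi>: "mult_char \<chi>" "\<chi> (-1 :: 'a) = 1"
  shows "\<exists>\<eta>. mult_char \<eta> \<and> \<chi> = (\<lambda>x. (\<eta> x)\<^sup>2)"
proof -
  define N where "N = CARD('a) - 1"
  obtain m where m: "N = 2 * m" using even_card_minus_1 unfolding N_def by (rule evenE)
  have m0: "m > 0"
  proof (rule Nat.gr0I)
    assume "m = 0"
    hence "CARD('a) \<le> 1" using m by (simp add: N_def)
    thus False using card_mono[of "UNIV::'a set" "{0,1}"] by auto
  qed
  have g0: "g \<noteq> 0" using g by (simp add: mult_generator_def)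
  have gN: "g ^ N = 1" using finite_field_power_card_minus_1[OF g0] by (simp add: N_def)
  hence "(g ^ m)\<^sup>2 = 1" by (simp add: m power_mult[symmetric] mult.commute)
  moreover have "g ^ m \<noteq> 1"
  proof
    assume "g ^ m = 1"
    hence "g ^ m = g ^ 0" by simp
    hence "m mod N = 0 mod N" by (simp only: mult_generator_power_eq_iff[OF g] N_def)
    thus False using m m0 by simp
  qed
  ultimately have "g ^ m = -1" by (simp add: power2_eq_1_iff)
  hence "\<chi> g ^ m = 1" using \<chi> by (metis mult_char_power)
  hence "csqrt (\<chi> g) ^ N = 1" by (simp add: m power_mult)
  then obtain \<eta> where \<eta>: "mult_char \<eta>" "\<eta> g = csqrt (\<chi> g)"
    using mult_char_exists[OF g] by (auto simp: N_def)
  have "\<chi> = (\<lambda>x. (\<eta> x)\<^sup>2)"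
  proof
    fix x show "\<chi> x = (\<eta> x)\<^sup>2"
      by (rule mult_char_eqI[OF g \<chi>(1) mult_char_pow[OF \<eta>(1)]]) (simp_all add: \<eta>)
  qed
  with \<eta> show ?thesis by blast
qed

text \<open>The summation set is stable under negation, which changes the sign of the sum.\<close>

lemma square_sum_odd_char:
  assumes "mult_char \<chi>" "\<chi> (-1 :: 'a) \<noteq> 1"
  shows "square_sum b \<chi> = 0"
proof -
  have "(\<chi> (-1))\<^sup>2 = \<chi> ((-1)\<^sup>2)" by (rule mult_char_power[OF assms(1), symmetric])
  hence "(\<chi> (-1))\<^sup>2 = 1" by (simp add: mult_charD[OF assms(1)])
  hence m1: "\<chi> (-1) = -1" using assms by (simp add: power2_eq_1_iff)
  have "square_sum b \<chi> = (\<Sum>x | Tr (x\<^sup>2) = b. \<chi> (-1 * x))"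
    unfolding square_sum_def by (rule sum.reindex_bij_witness[of _ uminus uminus]) auto
  also have "\<dots> = - square_sum b \<chi>"
    by (simp only: mult_charD[OF assms(1)] m1) (simp add: square_sum_def sum_negf)
  finally show ?thesis by simp
qed

lemma norm_square_sum_le:
  assumes \<chi>: "mult_char \<chi>" "nontrivial \<chi>" and b: "b \<in> F" "b \<noteq> 0"
  shows "norm (square_sum b \<chi>) \<le> 2 * X"
proof (cases "\<chi> (-1) = 1")
  case True
  obtain g :: 'a where g: "mult_generator g" using mult_generator_exists by blast
  obtain lam where lam: "mult_char lam" "lam g = -1" using quadratic_char_exists[OF g] by blast
  obtain \<eta> where \<eta>: "mult_char \<eta>" "\<chi> = (\<lambda>x. (\<eta> x)\<^sup>2)" using mult_char_sqrt[OF g \<chi>(1) True] by blast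
  \<comment> \<open>If \<open>\<eta> g\<close> were 1 or -1, then \<open>\<chi> g\<close> would be
    1. So neither \<open>\<eta>\<close> nor its product with \<open>lam\<close>, whose value at
    \<open>g\<close> is \<open>- \<eta> g\<close>, is trivial.\<close>
  have \<eta>g: "\<eta> g ^ 2 \<noteq> 1" using \<chi>(2) nontrivial_iff_generator[OF g \<chi>(1)] by (simp add: \<eta>(2))
  hence "nontrivial \<eta>" "nontrivial (\<lambda>x. lam x * \<eta> x)"
    using nontrivial_iff_generator[OF g] mult_char_mult[OF lam(1) \<eta>(1)] \<eta>(1) lam(2)
    by (auto simp: power2_eq_1_iff minus_equation_iff)
  hence "norm (fibre_sum b \<eta>) \<le> X" "norm (fibre_sum b (\<lambda>x. lam x * \<eta> x)) \<le> X"
    using norm_fibre_sum_le b \<eta>(1) mult_char_mult[OF lam(1) \<eta>(1)] by auto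
  thus ?thesis
    unfolding \<eta>(2) square_sum_of_square[OF g lam one_neq_minus_one \<eta>(1)]
    by (intro order.trans[OF norm_triangle_ineq]) simp
qed (simp add: square_sum_odd_char[OF \<chi>(1)] X_nonneg)

text \<open>The trivial character is its own square, so one of the two fibre sums is the size of the
  fibre, and only the sum of \<open>lam\<close> counts as an error.\<close>

lemma norm_square_sum_trivial:
  assumes b: "b \<in> F" "b \<noteq> 0"
  shows "norm (square_sum b (\<lambda>x. of_bool (x \<noteq> 0)) - of_nat q ^ (n - 1)) \<le> X"
proof -
  obtain g :: 'a where g: "mult_generator g" using mult_generator_exists by blast
  obtain lam where lam: "mult_char lam" "lam g = -1" using quadratic_char_exists[OF g] by blast
  have "nontrivial lam" using lam nontrivial_iff_generator[OF g lam(1)] by simp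
  hence "norm (fibre_sum b lam) \<le> X" using norm_fibre_sum_le lam b by blast
  moreover have "(\<lambda>x. (of_bool (x \<noteq> 0))\<^sup>2) = (\<lambda>x::'a. of_bool (x \<noteq> 0) :: complex)" by auto
  moreover have "(\<lambda>x. lam x * of_bool (x \<noteq> 0)) = lam" using mult_charD[OF lam(1)] by (auto simp: fun_eq_iff)
  ultimately show ?thesis
    using square_sum_of_square[OF g lam one_neq_minus_one mult_char_trivial, of b]
    by (simp add: fibre_sum_trivial b)
qed

end

section \<open>Characters of order \<open>l\<close> and the sieve weights\<close>

lemma coprime_powers_eq_1:
  fixes w :: "'a::monoid_mult"
  assumes "w ^ a = 1" "w ^ b = 1" "coprime a b"
  shows "w = 1"
proof (cases "a = 0")
  case False
  then obtain x y where "a * x = b * y + 1"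
    using bezout_nat[of a b] assms(3) by auto
  hence "w ^ (a * x) = w ^ (b * y) * w" by (simp add: power_commutes)
  thus ?thesis by (simp add: power_mult assms)
qed (use assms in simp)

text \<open>The equivalence identifies the kernel with the nonzero \<open>l\<close>-th powers, so
  one such character and its powers suffice to detect them.\<close>

definition is_order_char :: "nat \<Rightarrow> ('a::field \<Rightarrow> complex) \<Rightarrow> bool" where
  "is_order_char l \<rho> \<longleftrightarrow> mult_char \<rho> \<and> nontrivial \<rho> \<and>
     (\<forall>x. x \<noteq> 0 \<longrightarrow> \<rho> x ^ l = 1 \<and> (\<rho> x = 1 \<longleftrightarrow> (\<exists>z. x = z ^ l)))"

definition order_char :: "nat \<Rightarrow> 'a::field \<Rightarrow> complex" where
  "order_char l = (SOME \<rho>. is_order_char l \<rho>)"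

text \<open>A generator is sent to a primitive \<open>l\<close>-th root of unity; the value at
  \<open>g ^ i\<close> is then 1 exactly if \<open>l\<close> divides \<open>i\<close>.\<close>

lemma is_order_char_order_char:
  assumes "l > 1" "l dvd CARD('a::{field,finite}) - 1"
  shows "is_order_char l (order_char l :: 'a \<Rightarrow> complex)"
proof -
  obtain g :: 'a where g: "mult_generator g" using mult_generator_exists by blast
  define w where "w = cis (2 * pi / real l)"
  have w_eq_1_iff: "w ^ i = 1 \<longleftrightarrow> l dvd i" for i
  proof -
    have wl: "w ^ l = 1" using assms by (simp add: w_def DeMoivre)
    have "inj_on (\<lambda>k. cis (2 * pi * real k / real l)) {..<l}"
      using bij_betw_roots_unity[of l] assms by (auto simp: bij_betw_def)
    moreover have "w ^ k = cis (2 * pi * real k / real l)" for k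
      by (simp add: w_def DeMoivre mult.commute)
    ultimately have "inj_on (\<lambda>k. w ^ k) {..<l}" by simp
    hence "w ^ (i mod l) = w ^ 0 \<longleftrightarrow> i mod l = 0"
      using assms by (intro inj_on_eq_iff) auto
    thus ?thesis by (simp add: power_mod_period[OF wl] dvd_eq_mod_eq_0)
  qed
  have "w ^ (CARD('a) - 1) = 1" using assms by (simp only: w_eq_1_iff)
  then obtain \<rho> where \<rho>: "mult_char \<rho>" "\<rho> g = w" using mult_char_exists[OF g] by blast
  have "nontrivial \<rho>"
    using w_eq_1_iff[of 1] assms by (simp add: nontrivial_iff_generator[OF g \<rho>(1)] \<rho>(2))
  moreover have "\<rho> x ^ l = 1 \<and> (\<rho> x = 1 \<longleftrightarrow> (\<exists>z. x = z ^ l))" if "x \<noteq> 0" for x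
  proof -
    obtain i where i: "x = g ^ i" using g \<open>x \<noteq> 0\<close> unfolding mult_generator_def by blast
    hence \<rho>x: "\<rho> x = w ^ i" by (simp add: mult_char_power \<rho>)
    have pow: "\<rho> y ^ l = 1" if "y \<noteq> 0" for y
    proof -
      obtain j where "y = g ^ j" using g \<open>y \<noteq> 0\<close> unfolding mult_generator_def by blast
      thus ?thesis by (simp add: mult_char_power \<rho> power_mult[symmetric] w_eq_1_iff)
    qed
    have "\<exists>z. x = z ^ l" if "\<rho> x = 1"
    proof -
      have "l dvd i" using that by (simp add: \<rho>x w_eq_1_iff)
      then obtain j where "i = l * j" by (rule dvdE)
      hence "x = (g ^ j) ^ l" by (simp add: i mult.commute flip: power_mult)
      thus ?thesis ..
    qed
    moreover have "\<rho> x = 1" if "x = z ^ l" for z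
    proof -
      have "z \<noteq> 0" using that \<open>x \<noteq> 0\<close> assms by auto
      thus ?thesis using that pow by (simp add: mult_char_power \<rho>)
    qed
    ultimately show ?thesis using pow that by blast
  qed
  ultimately have "is_order_char l \<rho>" using \<rho> by (simp add: is_order_char_def)
  thus ?thesis unfolding order_char_def by (rule someI[of "is_order_char l"])
qed

definition sieve_weight :: "nat \<Rightarrow> 'a::field \<Rightarrow> complex" where
  "sieve_weight l x = 1 - (\<Sum>j=1..<l. order_char l x ^ j) / (of_nat l - 1)"

text \<open>On \<open>l\<close>-th powers all \<open>l - 1\<close> terms are 1 and the weight is 0.
  Elsewhere the full geometric sum vanishes, so the terms from \<open>j = 1\<close> on add up to -1
  and the weight is \<open>l / (l - 1)\<close>.\<close>

lemma sieve_weight_eq: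
  fixes x :: "'a::{field,finite}"
  assumes l: "l > 1" "l dvd CARD('a) - 1" and x: "x \<noteq> 0"
  shows "sieve_weight l x = of_bool (\<nexists>z. x = z ^ l) / (1 - 1 / of_nat l)"
proof -
  let ?w = "order_char l x"
  have \<rho>: "?w ^ l = 1" "?w = 1 \<longleftrightarrow> (\<exists>z. x = z ^ l)"
    using is_order_char_order_char[OF l] x by (auto simp: is_order_char_def)
  have l1: "of_nat l - (1::complex) \<noteq> 0" "of_nat l \<noteq> (0::complex)" using l by auto
  show ?thesis
  proof (cases "?w = 1")
    case True
    thus ?thesis using l l1 \<rho> by (simp add: sieve_weight_def of_nat_diff)
  next
    case False
    have "(\<Sum>j<l. ?w ^ j) = 0" using False \<rho> by (simp add: sum_gp_strict)
    moreover have "(\<Sum>j<l. ?w ^ j) = 1 + (\<Sum>j=1..<l. ?w ^ j)"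
      using l by (simp add: lessThan_atLeast0 sum.atLeast_Suc_lessThan)
    ultimately have "(\<Sum>j=1..<l. ?w ^ j) = -1" by (simp add: eq_neg_iff_add_eq_0 add.commute)
    thus ?thesis using False \<rho> l1 by (simp add: sieve_weight_def field_simps)
  qed
qed

context finite_extension
begin

definition sieve_sum :: "'a \<Rightarrow> nat set \<Rightarrow> ('a \<Rightarrow> complex) \<Rightarrow> complex" where
  "sieve_sum b S \<chi> = square_sum b (\<lambda>x. \<chi> x * (\<Prod>l\<in>S. sieve_weight l x))"

text \<open>The correction is an average of \<open>l - 1\<close> twisted sums, so a uniform bound
  for these carries over to it, whatever the size of \<open>l\<close>.\<close>

lemma sieve_sum_insert:
  assumes "finite S" "l \<notin> S"
  shows "sieve_sum b (insert l S) \<chi> =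
    sieve_sum b S \<chi> - (\<Sum>j=1..<l. sieve_sum b S (\<lambda>x. \<chi> x * order_char l x ^ j)) / (of_nat l - 1)"
proof -
  let ?P = "\<lambda>x. \<Prod>l\<in>S. sieve_weight l x"
  have "sieve_sum b (insert l S) \<chi> =
    (\<Sum>x | Tr (x\<^sup>2) = b. \<chi> x * ?P x - (\<Sum>j=1..<l. \<chi> x * order_char l x ^ j * ?P x) / (of_nat l - 1))"
    unfolding sieve_sum_def square_sum_def
    by (intro sum.cong refl)
       (use assms in \<open>simp add: sieve_weight_def[of l] algebra_simps sum_distrib_left sum_distrib_right
          sum_divide_distrib\<close>)
  also have "\<dots> = sieve_sum b S \<chi>
     - (\<Sum>x | Tr (x\<^sup>2) = b. \<Sum>j=1..<l. \<chi> x * order_char l x ^ j * ?P x) / (of_nat l - 1)"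
    by (simp add: sieve_sum_def square_sum_def sum_subtractf sum_divide_distrib)
  also have "(\<Sum>x | Tr (x\<^sup>2) = b. \<Sum>j=1..<l. \<chi> x * order_char l x ^ j * ?P x)
     = (\<Sum>j=1..<l. sieve_sum b S (\<lambda>x. \<chi> x * order_char l x ^ j))"
    unfolding sieve_sum_def square_sum_def by (rule sum.swap)
  finally show ?thesis .
qed

lemma sieve_sum_trivial:
  assumes "b \<noteq> 0" "finite S" "\<And>l. l \<in> S \<Longrightarrow> l > 1 \<and> l dvd CARD('a) - 1"
  shows "of_nat (card {x. x \<noteq> 0 \<and> (\<forall>l\<in>S. \<nexists>z. x = z ^ l) \<and> Tr (x\<^sup>2) = b})
    = of_real (\<Prod>l\<in>S. 1 - 1 / real l) * sieve_sum b S (\<lambda>x. of_bool (x \<noteq> 0))"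
proof -
  let ?t = "of_real (\<Prod>l\<in>S. 1 - 1 / real l) :: complex"
  have t: "?t = (\<Prod>l\<in>S. 1 - 1 / of_nat l)" by simp
  have t0: "?t \<noteq> 0" using assms by (auto simp: t)
  have w: "?t * (of_bool (x \<noteq> 0) * (\<Prod>l\<in>S. sieve_weight l x))
      = of_bool (x \<noteq> 0 \<and> (\<forall>l\<in>S. \<nexists>z. x = z ^ l))" for x :: 'a
  proof (cases "x = 0")
    case False
    have "(\<Prod>l\<in>S. sieve_weight l x) = (\<Prod>l\<in>S. of_bool (\<nexists>z. x = z ^ l) / (1 - 1 / of_nat l))"
      using assms False by (intro prod.cong refl sieve_weight_eq) auto
    also have "\<dots> = (\<Prod>l\<in>S. of_bool (\<nexists>z. x = z ^ l)) / ?t" by (simp add: prod_dividef t)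
    also have "(\<Prod>l\<in>S. of_bool (\<nexists>z. x = z ^ l)) = (of_bool (\<forall>l\<in>S. \<nexists>z. x = z ^ l) :: complex)"
      using assms(2) by (induction S) auto
    finally show ?thesis using False t0 by simp
  qed simp
  have "?t * sieve_sum b S (\<lambda>x. of_bool (x \<noteq> 0))
     = (\<Sum>x | Tr (x\<^sup>2) = b. of_bool (x \<noteq> 0 \<and> (\<forall>l\<in>S. \<nexists>z. x = z ^ l)))"
    unfolding sieve_sum_def square_sum_def sum_distrib_left w ..
  also have "\<dots> = of_nat (card {x. x \<noteq> 0 \<and> (\<forall>l\<in>S. \<nexists>z. x = z ^ l) \<and> Tr (x\<^sup>2) = b})"
    by (simp add: Int_def conj_ac)
  finally show ?thesis ..
qed

end

text \<open>If the order of \<open>\<chi>\<close> is prime to \<open>l\<close>, then no power occurring in \<open>sieve_weight l\<close> can cancel it.\<close>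

lemma mult_char_times_order_char:
  fixes \<chi> :: "'a::{field,finite} \<Rightarrow> complex"
  assumes \<chi>: "mult_char \<chi>" "\<And>x. x \<noteq> 0 \<Longrightarrow> \<chi> x ^ m = 1"
    and l: "prime l" "l dvd CARD('a) - 1" "\<not> l dvd m" and j: "j \<in> {1..<l}"
  shows "mult_char (\<lambda>x. \<chi> x * order_char l x ^ j)" "nontrivial (\<lambda>x. \<chi> x * order_char l x ^ j)"
    "\<And>x. x \<noteq> 0 \<Longrightarrow> (\<chi> x * order_char l x ^ j) ^ (m * l) = 1"
proof -
  have oc: "is_order_char l (order_char l :: 'a \<Rightarrow> complex)"
    using prime_gt_1_nat l by (intro is_order_char_order_char) blast+
  thus "mult_char (\<lambda>x. \<chi> x * order_char l x ^ j)"
    using \<chi> j by (intro mult_char_mult mult_char_pow) (auto simp: is_order_char_def)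
  have pl: "order_char l x ^ l = 1" if "x \<noteq> 0" for x :: 'a
    using oc that by (simp add: is_order_char_def)
  show "(\<chi> x * order_char l x ^ j) ^ (m * l) = 1" if "x \<noteq> 0" for x
  proof -
    have "(\<chi> x * order_char l x ^ j) ^ (m * l) = (\<chi> x ^ m) ^ l * (order_char l x ^ l) ^ (j * m)"
      by (simp add: power_mult_distrib power_mult[symmetric] mult_ac)
    thus ?thesis by (simp add: \<chi> pl that)
  qed
  show "nontrivial (\<lambda>x. \<chi> x * order_char l x ^ j)"
  proof (rule ccontr)
    assume *: "\<not> nontrivial (\<lambda>x. \<chi> x * order_char l x ^ j)"
    obtain x :: 'a where x: "x \<noteq> 0" "order_char l x \<noteq> 1"
      using oc by (auto simp: is_order_char_def nontrivial_def)
    have "(\<chi> x * order_char l x ^ j) ^ m = 1" using * x by (auto simp: nontrivial_def)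
    hence "order_char l x ^ (j * m) = 1"
      by (simp add: power_mult_distrib \<chi>(2)[OF x(1)] power_mult)
    moreover have "coprime (j * m) l"
    proof -
      have "\<not> l dvd j" using j by (auto dest: dvd_imp_le)
      hence "\<not> l dvd j * m" using l by (simp add: prime_dvd_mult_iff)
      thus ?thesis using l by (metis coprime_commute prime_imp_coprime)
    qed
    ultimately show False using coprime_powers_eq_1 pl[OF x(1)] x(2) by blast
  qed
qed

section \<open>Error bounds for the sieved sums\<close>

context odd_finite_extension
begin

context
  fixes b assumes b: "b \<in> F" "b \<noteq> 0"
begin

text \<open>The induction hypothesis is a premise, so that the step serves trivial and nontrivial
  \<open>\<chi>\<close> alike: the twists by powers of \<open>order_char l\<close> are nontrivial in
  either case.\<close>

lemma norm_sieve_sum_insert: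
  assumes IH: "\<And>\<chi> m. mult_char \<chi> \<Longrightarrow> nontrivial \<chi> \<Longrightarrow> (\<And>x. x \<noteq> 0 \<Longrightarrow> \<chi> x ^ m = 1) \<Longrightarrow>
       (\<And>l. l \<in> S \<Longrightarrow> \<not> l dvd m) \<Longrightarrow> norm (sieve_sum b S \<chi>) \<le> B"
    and S: "finite S" "\<And>l. l \<in> S \<Longrightarrow> prime l"
    and \<chi>: "mult_char \<chi>" "\<And>x. x \<noteq> 0 \<Longrightarrow> \<chi> x ^ m = 1" "\<And>l. l \<in> S \<Longrightarrow> \<not> l dvd m"
    and l: "l \<notin> S" "prime l" "l dvd CARD('a) - 1" "\<not> l dvd m"
  shows "norm (sieve_sum b (insert l S) \<chi> - sieve_sum b S \<chi>) \<le> B"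
proof -
  have l1: "real l - 1 > 0" using prime_gt_1_nat[OF l(2)] by simp
  \<comment> \<open>The twisted character has exponent \<open>m * l\<close>, which is still
    divisible by no prime of \<open>S\<close>, since \<open>l \<notin> S\<close>.\<close>
  have bound: "norm (sieve_sum b S (\<lambda>x. \<chi> x * order_char l x ^ j)) \<le> B" if j: "j \<in> {1..<l}" for j
  proof (rule IH[where m = "m * l"])
    fix l' assume l': "l' \<in> S"
    hence "\<not> l' dvd l" using l S by (metis primes_dvd_imp_eq)
    thus "\<not> l' dvd m * l" using l' \<chi>(3) S by (simp add: prime_dvd_mult_iff)
  qed (use mult_char_times_order_char[OF \<chi>(1,2) l(2-4) j] in auto)
  have "norm (\<Sum>j=1..<l. sieve_sum b S (\<lambda>x. \<chi> x * order_char l x ^ j)) \<le> (\<Sum>j=1..<l. B)"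
    by (intro sum_norm_le bound)
  also have "\<dots> = (real l - 1) * B" using l1 by (simp add: of_nat_diff)
  finally have "norm (\<Sum>j=1..<l. sieve_sum b S (\<lambda>x. \<chi> x * order_char l x ^ j)) / (real l - 1) \<le> B"
    using l1 by (simp add: field_simps)
  moreover have "norm (of_nat l - 1 :: complex) = real l - 1"
    using l1 by (metis abs_of_pos norm_of_real of_real_1 of_real_diff of_real_of_nat_eq)
  ultimately show ?thesis
    using S l by (simp add: sieve_sum_insert norm_divide)
qed

text \<open>Inserting a prime adds at most the bound for the smaller set, whence the doubling. The
  exponent \<open>m\<close> is generalised because twisting enlarges it.\<close>

lemma norm_sieve_sum_nontrivial:
  assumes "finite S" "\<And>l. l \<in> S \<Longrightarrow> prime l \<and> l dvd CARD('a) - 1"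
    and "mult_char \<chi>" "nontrivial \<chi>" "\<And>x. x \<noteq> 0 \<Longrightarrow> \<chi> x ^ m = 1" "\<And>l. l \<in> S \<Longrightarrow> \<not> l dvd m"
  shows "norm (sieve_sum b S \<chi>) \<le> 2 * X * 2 ^ card S"
  using assms
proof (induction S arbitrary: \<chi> m rule: finite_induct)
  case empty
  thus ?case using norm_square_sum_le b by (simp add: sieve_sum_def)
next
  case (insert l S)
  have IH: "norm (sieve_sum b S \<chi>) \<le> 2 * X * 2 ^ card S"
    if "mult_char \<chi>" "nontrivial \<chi>" "\<And>x. x \<noteq> 0 \<Longrightarrow> \<chi> x ^ m = 1" "\<And>l. l \<in> S \<Longrightarrow> \<not> l dvd m" for \<chi> m
    by (rule insert.IH[of _ m]) (use insert.prems(1) that in blast)+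
  have "norm (sieve_sum b (insert l S) \<chi> - sieve_sum b S \<chi>) \<le> 2 * X * 2 ^ card S"
    by (rule norm_sieve_sum_insert[OF IH, where m = m]) (use insert.hyps insert.prems in blast)+
  moreover have "norm (sieve_sum b S \<chi>) \<le> 2 * X * 2 ^ card S"
    by (rule IH[of _ m]) (use insert.prems in blast)+
  moreover have "norm (sieve_sum b (insert l S) \<chi>)
      \<le> norm (sieve_sum b S \<chi>) + norm (sieve_sum b (insert l S) \<chi> - sieve_sum b S \<chi>)"
    by (rule norm_triangle_sub)
  ultimately show ?case using insert.hyps by simp
qed

text \<open>The main term \<open>q ^ (n - 1)\<close> cancels in the difference: only nontrivial
  twists remain, starting from a character of exponent 1.\<close>

lemma norm_sieve_sum_insert_trivial:
  assumes "finite S" "\<And>l. l \<in> S \<Longrightarrow> prime l \<and> l dvd CARD('a) - 1"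
    and "l \<notin> S" "prime l" "l dvd CARD('a) - 1"
  shows "norm (sieve_sum b (insert l S) (\<lambda>x. of_bool (x \<noteq> 0)) - sieve_sum b S (\<lambda>x. of_bool (x \<noteq> 0)))
    \<le> 2 * X * 2 ^ card S"
proof -
  have not_dvd: "\<not> l' dvd 1" if "prime l'" for l' :: nat
    using that by (metis nat_dvd_1_iff_1 not_prime_1)
  show ?thesis
  proof (rule norm_sieve_sum_insert[where m = 1])
    fix \<chi> :: "'a \<Rightarrow> complex" and m
    assume *: "mult_char \<chi>" "nontrivial \<chi>" "\<And>x. x \<noteq> 0 \<Longrightarrow> \<chi> x ^ m = 1" "\<And>l. l \<in> S \<Longrightarrow> \<not> l dvd m"
    show "norm (sieve_sum b S \<chi>) \<le> 2 * X * 2 ^ card S"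
      by (rule norm_sieve_sum_nontrivial[where m = m]) (use assms * in blast)+
  next
    show "mult_char (\<lambda>x::'a. of_bool (x \<noteq> 0))" by (rule mult_char_trivial)
    show "of_bool (x \<noteq> 0) ^ 1 = (1::complex)" if "x \<noteq> 0" for x :: 'a using that by simp
    show "prime l'" "\<not> l' dvd 1" if "l' \<in> S" for l'
      using assms(2)[OF that] not_dvd[of l'] by auto
    show "\<not> l dvd 1" by (rule not_dvd) (rule assms(4))
  qed (rule assms)+
qed

text \<open>At the empty set the error \<open>X\<close> is weakened to \<open>2 * X\<close>, so that
  it doubles in step with the bound for each inserted prime.\<close>

lemma norm_sieve_sum_trivial:
  assumes "finite S" "\<And>l. l \<in> S \<Longrightarrow> prime l \<and> l dvd CARD('a) - 1"
  shows "norm (sieve_sum b S (\<lambda>x. of_bool (x \<noteq> 0)) - of_nat q ^ (n - 1)) \<le> 2 * X * 2 ^ card S"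
  using assms
proof (induction S rule: finite_induct)
  case empty
  thus ?case using norm_square_sum_trivial[OF b] X_nonneg by (simp add: sieve_sum_def)
next
  case (insert l S)
  let ?s = "\<lambda>S. sieve_sum b S (\<lambda>x. of_bool (x \<noteq> 0))"
  have "norm (?s (insert l S) - of_nat q ^ (n - 1))
      \<le> norm (?s (insert l S) - ?s S) + norm (?s S - of_nat q ^ (n - 1))"
    using norm_triangle_ineq[of "?s (insert l S) - ?s S" "?s S - of_nat q ^ (n - 1)"] by simp
  also have "\<dots> \<le> 2 * X * 2 ^ card S + 2 * X * 2 ^ card S"
  proof (rule add_mono)
    show "norm (?s (insert l S) - ?s S) \<le> 2 * X * 2 ^ card S"
      by (rule norm_sieve_sum_insert_trivial) (use insert.hyps insert.prems in blast)+
    show "norm (?s S - of_nat q ^ (n - 1)) \<le> 2 * X * 2 ^ card S"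
      by (rule insert.IH) (use insert.prems in blast)
  qed
  finally show ?case using insert.hyps by simp
qed

section \<open>The prime sieve\<close>

definition free_count :: "nat set \<Rightarrow> nat" where
  "free_count S = card {x. x \<noteq> 0 \<and> (\<forall>l\<in>S. \<nexists>z. x = z ^ l) \<and> Tr (x\<^sup>2) = b}"

text \<open>An element lost on passing from \<open>S\<close> to \<open>S \<union> P\<close> is an
  \<open>l\<close>-th power for some \<open>l\<close> in \<open>P\<close>; the union bound counts
  these.\<close>

lemma free_count_sieve:
  assumes "finite P"
  shows "real (free_count (S \<union> P)) \<ge> real (free_count S)
    - (\<Sum>l\<in>P. real (free_count S) - real (free_count (insert l S)))"
proof -
  define A where "A = (\<lambda>S. {x. x \<noteq> 0 \<and> (\<forall>l\<in>S. \<nexists>z. x = z ^ l) \<and> Tr (x\<^sup>2) = b})"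
  have fc: "free_count S = card (A S)" for S by (simp add: free_count_def A_def)
  have sub: "A (insert l S) \<subseteq> A S" "A (S \<union> P) \<subseteq> A S" for l by (auto simp: A_def)
  have "A S - A (S \<union> P) \<subseteq> (\<Union>l\<in>P. A S - A (insert l S))" by (auto simp: A_def)
  hence "card (A S - A (S \<union> P)) \<le> card (\<Union>l\<in>P. A S - A (insert l S))"
    by (intro card_mono) auto
  also have "\<dots> \<le> (\<Sum>l\<in>P. card (A S - A (insert l S)))"
    by (rule card_UN_le[OF assms])
  finally have "real (card (A S - A (S \<union> P))) \<le> (\<Sum>l\<in>P. real (card (A S - A (insert l S))))"
    by (simp flip: of_nat_sum)
  moreover have "real (card (A S - A T)) = real (free_count S) - real (free_count T)"
    if "A T \<subseteq> A S" for T
    using that by (simp add: fc card_Diff_subset card_mono of_nat_diff)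
  ultimately show ?thesis using sub by simp
qed

text \<open>Each sieving prime is compared with \<open>S\<close> only: \<open>h (insert l S)\<close>
  falls below \<open>h S\<close> by at most \<open>E\<close>. Summation leaves \<open>h S\<close>
  with the factor \<open>D > 0\<close>, so the estimate against the main term is needed just once,
  for \<open>h S\<close> itself.\<close>

lemma free_count_lower_bound:
  assumes S: "finite S" "\<And>l. l \<in> S \<Longrightarrow> prime l \<and> l dvd CARD('a) - 1"
    and P: "finite P" "\<And>l. l \<in> P \<Longrightarrow> prime l \<and> l dvd CARD('a) - 1" and disj: "S \<inter> P = {}"
    and D: "D = 1 - (\<Sum>l\<in>P. 1 / real l)" "D > 0"
  shows "real (free_count (S \<union> P)) \<ge>
    (\<Prod>l\<in>S. 1 - 1 / real l) * X * (D * X - 2 * 2 ^ card S * (real (card P) - 1 + 2 * D))"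
proof -
  define h where "h = (\<lambda>S. Re (sieve_sum b S (\<lambda>x. of_bool (x \<noteq> 0))))"
  define a where "a = (\<Prod>l\<in>S. 1 - 1 / real l)"
  define E where "E = 2 * X * 2 ^ card S"
  have fc: "real (free_count T) = (\<Prod>l\<in>T. 1 - 1 / real l) * h T"
    if "finite T" "\<And>l. l \<in> T \<Longrightarrow> prime l \<and> l dvd CARD('a) - 1" for T
  proof -
    have "l > 1 \<and> l dvd CARD('a) - 1" if "l \<in> T" for l
      using \<open>l \<in> T \<Longrightarrow> prime l \<and> l dvd CARD('a) - 1\<close> that prime_gt_1_nat by blast
    with sieve_sum_trivial[OF b(2) \<open>finite T\<close>]
    have "of_nat (free_count T)
        = complex_of_real (\<Prod>l\<in>T. 1 - 1 / real l) * sieve_sum b T (\<lambda>x. of_bool (x \<noteq> 0))"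
      unfolding free_count_def by blast
    hence "Re (of_nat (free_count T)) = Re (complex_of_real (\<Prod>l\<in>T. 1 - 1 / real l) *
        sieve_sum b T (\<lambda>x. of_bool (x \<noteq> 0)))" by (simp only:)
    thus ?thesis by (simp only: Re_complex_of_real Im_complex_of_real times_complex.sel h_def) simp
  qed
  have ge1: "1 / real l \<le> 1" if "prime l" for l
    using prime_ge_1_nat[OF that] by (simp add: divide_le_eq)
  have a0: "a \<ge> 0" unfolding a_def
    using S ge1 by (intro prod_nonneg) (simp add: diff_ge_0_iff_ge)
  have h0: "h S \<ge> X\<^sup>2 - E"
  proof -
    have "\<bar>Re (sieve_sum b S (\<lambda>x. of_bool (x \<noteq> 0)) - of_nat q ^ (n - 1))\<bar> \<le> E"
      unfolding E_def using norm_sieve_sum_trivial[OF S] by (rule order.trans[OF abs_Re_le_cmod])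
    moreover have "Re (of_nat q ^ (n - 1)) = real q ^ (n - 1)"
      by (metis Re_complex_of_real of_real_of_nat_eq of_real_power)
    ultimately show ?thesis by (simp add: h_def X_sq)
  qed
  have hl: "h (insert l S) - h S \<ge> - E" if "l \<in> P" for l
  proof -
    have "\<bar>Re (sieve_sum b (insert l S) (\<lambda>x. of_bool (x \<noteq> 0)) - sieve_sum b S (\<lambda>x. of_bool (x \<noteq> 0)))\<bar> \<le> E"
      unfolding E_def
      by (rule order.trans[OF abs_Re_le_cmod norm_sieve_sum_insert_trivial])
         (use that disj S P in blast)+
    thus ?thesis by (simp add: h_def)
  qed
  \<comment> \<open>The errors \<open>E\<close> carry the weights \<open>1 - 1 / l\<close>; their
    total is the origin of \<open>s - 1\<close> in the claim.\<close>
  have sumP: "(\<Sum>l\<in>P. 1 - 1 / real l) = real (card P) - 1 + D"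
    by (simp add: D sum_subtractf)
  have "(\<Sum>l\<in>P. real (free_count S) - real (free_count (insert l S)))
      = (\<Sum>l\<in>P. a * (h S - (1 - 1 / real l) * h (insert l S)))"
  proof (intro sum.cong refl)
    fix l assume l: "l \<in> P"
    hence "l \<notin> S" using disj by auto
    hence "real (free_count (insert l S)) = (1 - 1 / real l) * a * h (insert l S)"
      unfolding a_def using S P l by (subst fc) auto
    moreover have "real (free_count S) = a * h S" unfolding a_def by (rule fc[OF S])
    ultimately show "real (free_count S) - real (free_count (insert l S))
      = a * (h S - (1 - 1 / real l) * h (insert l S))" by (simp add: algebra_simps)
  qed
  also have "\<dots> \<le> (\<Sum>l\<in>P. a * (h S * (1 / real l) + (1 - 1 / real l) * E))"
  proof (intro sum_mono mult_left_mono a0)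
    fix l assume l: "l \<in> P"
    hence "1 / real l \<le> 1" using P ge1 by blast
    hence "(1 - 1 / real l) * (h (insert l S) - h S) \<ge> (1 - 1 / real l) * (- E)"
      using hl[OF l] by (intro mult_left_mono) auto
    thus "h S - (1 - 1 / real l) * h (insert l S) \<le> h S * (1 / real l) + (1 - 1 / real l) * E"
      by (simp add: algebra_simps)
  qed
  also have "\<dots> = a * (h S * (\<Sum>l\<in>P. 1 / real l) + (\<Sum>l\<in>P. 1 - 1 / real l) * E)"
    by (simp only: sum.distrib sum_distrib_left[symmetric] sum_distrib_right[symmetric])
  also have "\<dots> = a * (h S * (1 - D) + (real (card P) - 1 + D) * E)"
    unfolding sumP by (simp add: D)
  finally have "real (free_count (S \<union> P)) \<ge> a * h S - a * (h S * (1 - D) + (real (card P) - 1 + D) * E)"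
    using free_count_sieve[OF P(1), of S] fc[OF S] by (simp add: a_def)
  moreover have "a * h S - a * (h S * (1 - D) + (real (card P) - 1 + D) * E)
      = a * (D * h S - (real (card P) - 1 + D) * E)" by (simp add: algebra_simps)
  moreover have "a * (D * h S - (real (card P) - 1 + D) * E)
      \<ge> a * (D * (X\<^sup>2 - E) - (real (card P) - 1 + D) * E)"
    using h0 D a0 by (intro mult_left_mono diff_right_mono) auto
  \<comment> \<open>Estimating \<open>h S\<close> costs a further \<open>D * E\<close>, which turns
    the \<open>D\<close> collected so far into \<open>2 * D\<close>.\<close>
  moreover have "a * (D * (X\<^sup>2 - E) - (real (card P) - 1 + D) * E)
      = a * X * (D * X - 2 * 2 ^ card S * (real (card P) - 1 + 2 * D))"
    by (simp add: E_def power2_eq_square algebra_simps)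
  ultimately show ?thesis unfolding a_def by linarith
qed

end
end

section \<open>From free elements to the sieve, and the final estimate\<close>

text \<open>Prime exponents suffice, because a \<open>d\<close>-th power is an \<open>l\<close>-th
  power for every prime \<open>l\<close> dividing \<open>d\<close>.\<close>

lemma m_free_iff:
  fixes x :: "'a::field"
  assumes "m > 0"
  shows "m_free m x \<longleftrightarrow> x \<noteq> 0 \<and> (\<forall>l\<in>prime_factors m. \<nexists>z. x = z ^ l)"
proof (intro iffI conjI ballI notI; (elim exE conjE)?)
  fix l z assume *: "m_free m x" "l \<in> prime_factors m" "x = z ^ l"
  hence "prime l" "l dvd m" by auto
  moreover from this have "z \<noteq> 0" using * by (auto simp: m_free_def power_0_left prime_gt_0_nat)
  ultimately have "l = 1" using * by (auto simp: m_free_def)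
  thus False using \<open>prime l\<close> by simp
next
  assume *: "x \<noteq> 0" "\<forall>l\<in>prime_factors m. \<nexists>z. x = z ^ l"
  show "m_free m x" unfolding m_free_def
  proof (intro conjI allI impI)
    fix d z assume d: "d dvd m \<and> z \<noteq> 0 \<and> x = z ^ d"
    show "d = 1"
    proof (rule ccontr)
      assume "d \<noteq> 1"
      then obtain l where l: "prime l" "l dvd d" using prime_factor_nat by blast
      from l(2) obtain e where "d = l * e" by (rule dvdE)
      hence "x = (z ^ e) ^ l" using d by (simp add: mult.commute flip: power_mult)
      moreover have "l \<in> prime_factors m"
        using l d assms by (auto simp: prime_factors_dvd intro: dvd_trans)
      ultimately show False using * by blast
    qed
  qed (use * in simp)
qed (auto simp: m_free_def)

theorem theorem6p2:
  fixes F :: "'a::{field,finite} set" and \<beta> :: 'a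
    and q n Q k kQ r s :: nat and p :: "nat \<Rightarrow> nat" and \<delta> \<delta>Q :: real
  assumes "primepow q" and "odd q" and "prime n" and "even ((q ^ n - 1) div 2)"
    and "CARD('a) = q ^ n" and "is_subfield F" and "card F = q"
    and "\<beta> \<in> F" and "\<beta> \<noteq> 0"
    and "Q = (q ^ n - 1) div (q - 1)"
    and "k * (\<Prod>i=1..s. p i) = \<Prod>(prime_factors (q ^ n - 1))"
    and "\<forall>i\<in>{1..s}. prime (p i) \<and> \<not> p i dvd k" and "inj_on p {1..s}"
    and "r \<le> s" and "\<forall>i\<in>{1..r}. p i dvd Q" and "\<forall>i\<in>{r<..s}. \<not> p i dvd Q"
    and "\<delta> = 1 - (\<Sum>i=1..s. 1 / real (p i))"
    and "\<delta>Q = 1 - (\<Sum>i=1..r. 1 / real (p i))"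
    and "kQ = \<Prod>{l \<in> prime_factors k. l dvd Q}"
    and "\<delta> > 0"
  shows "real (N_free q n \<beta> (q ^ n - 1)) \<ge>
      \<delta> * \<theta> k * real q powr ((real n - 1) / 2) *
        (real q powr ((real n - 1) / 2)
          - 4 * ((real s - 1) / \<delta> + 2) * real (W k)
          + 2 * ((real r - 1 + \<delta>Q) / \<delta> + 1) * real (W kQ))
    \<and> (real q powr ((real n - 1) / 2) >
          4 * ((real s - 1) / \<delta> + 2) * real (W k)
          - 2 * ((real r - 1 + \<delta>Q) / \<delta> + 1) * real (W kQ)
        \<longrightarrow> N_free q n \<beta> (q ^ n - 1) > 0)"
proof -
  interpret odd_finite_extension F q n
    using assms(1,2,5-7) prime_gt_0_nat[OF assms(3)] by unfold_locales
  define M where "M = q ^ n - 1"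
  define S where "S = prime_factors k"
  define P where "P = p ` {1..s}"
  have M0: "M > 0" using one_less_power[OF q_gt_1 n_pos] by (simp add: M_def)
  have pf_prod: "prime_factors (\<Prod>A) = A" if "finite A" "\<And>l. l \<in> A \<Longrightarrow> prime l" for A :: "nat set"
  proof -
    have "0 \<notin> A" using that(2) not_prime_0 by blast
    thus ?thesis using that by (subst prime_factors_prod) (auto simp: prime_prime_factors)
  qed
  have rad: "k * \<Prod>P = \<Prod>(prime_factors M)"
    using assms(11,13) by (simp add: M_def P_def prod.reindex)
  moreover have "\<Prod>(prime_factors M) > 0" 
    by (intro prod_pos) (blast intro: prime_gt_0_nat in_prime_factors_imp_prime)
  \<comment> \<open>The radical of \<open>M\<close> is positive, so neither factor is 0 and the
    prime factors of the product are those of \<open>k\<close> and of \<open>\<Prod>P\<close>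
    together.\<close>
  ultimately have k0: "k > 0" and P0: "\<Prod>P > 0" by (metis mult_eq_0_iff neq0_conv)+
  have P: "finite P" "\<And>l. l \<in> P \<Longrightarrow> prime l" using assms(12) by (auto simp: P_def)
  have "prime_factors M = prime_factors (k * \<Prod>P)"
    unfolding rad by (rule pf_prod[symmetric]) auto
  also have "\<dots> = S \<union> P"
    using k0 P0 by (subst prime_factors_product) (simp_all only: pf_prod[OF P] S_def neq0_conv)
  finally have SP: "prime_factors M = S \<union> P" .
  have disj: "S \<inter> P = {}" using assms(12) by (auto simp: S_def P_def)
  have prS: "prime l \<and> l dvd CARD('a) - 1" if "l \<in> S \<union> P" for l
    using that unfolding SP[symmetric] by (auto simp: M_def card_UNIV)
  have finS: "finite S" by (simp add: S_def)
  have cardP: "card P = s" unfolding P_def using card_image[OF assms(13)] by simp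
  have D: "\<delta> = 1 - (\<Sum>l\<in>P. 1 / real l)"
    unfolding assms(17) P_def by (subst sum.reindex[OF assms(13)]) simp
  have \<theta>: "\<theta> k = (\<Prod>l\<in>S. 1 - 1 / real l)"
    using k0 by (simp add: \<theta>_def totient_formula2 S_def)
  have \<theta>_pos: "\<theta> k > 0" using k0 by (simp add: \<theta>_def)
  have N: "N_free q n \<beta> M = free_count \<beta> (S \<union> P)"
    by (simp add: N_free_def free_count_def[OF assms(8,9)] m_free_iff[OF M0] SP conj_assoc)
  define Y where "Y = real q powr ((real n - 1) / 2)"
  have Y_pos: "Y > 0" using q_gt_1 by (simp add: Y_def)
  have XY: "X = Y"
  proof -
    have "X = sqrt (real q powr (real n - 1))"
      using q_gt_1 n_pos by (simp add: X_def powr_realpow[symmetric] of_nat_diff)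
    thus ?thesis by (simp add: Y_def powr_half_sqrt_powr)
  qed
  define WQ where "WQ = real (W kQ)"
  define w where "w = real (W k)"
  have w: "w = 2 ^ card S" by (simp add: w_def W_def \<nu>_def S_def)
  have WQ: "0 \<le> WQ" "WQ \<le> w"
  proof -
    have "prime_factors kQ = {l \<in> prime_factors k. l dvd Q}"
      unfolding assms(19) by (rule pf_prod) auto
    hence "\<nu> kQ \<le> \<nu> k" unfolding \<nu>_def by (auto intro!: card_mono)
    thus "WQ \<le> w" by (simp add: WQ_def w_def W_def power_increasing)
  qed (simp add: WQ_def)
  define u where "u = (real s - 1) / \<delta> + 2"
  define v where "v = (real r - 1 + \<delta>Q) / \<delta> + 1"
  \<comment> \<open>Both numerators are sums of the nonnegative numbers \<open>1 - 1 / p i\<close>,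
    over \<open>r\<close> and over \<open>s\<close> terms, once \<open>u\<close> is written as
    \<open>(s - 1 + \<delta>) / \<delta> + 1\<close>.\<close>
  have v: "0 \<le> v" "v \<le> u"
  proof -
    have pi: "0 \<le> 1 - 1 / real (p i)" if "i \<in> {1..s}" for i
      using assms(12) that prime_ge_1_nat[of "p i"] by auto
    have r: "real r - 1 + \<delta>Q = (\<Sum>i=1..r. 1 - 1 / real (p i))" by (simp add: assms(18) sum_subtractf)
    have s: "real s - 1 + \<delta> = (\<Sum>i=1..s. 1 - 1 / real (p i))" by (simp add: assms(17) sum_subtractf)
    have "0 \<le> real r - 1 + \<delta>Q" unfolding r using pi assms(14) by (intro sum_nonneg) auto
    thus "0 \<le> v" using assms(20) by (simp add: v_def)
    have "real r - 1 + \<delta>Q \<le> real s - 1 + \<delta>"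
      unfolding r s using pi assms(14) by (intro sum_mono2) auto
    hence "(real r - 1 + \<delta>Q) / \<delta> \<le> (real s - 1 + \<delta>) / \<delta>"
      using assms(20) by (intro divide_right_mono) auto
    also have "\<dots> = (real s - 1) / \<delta> + 1" using assms(20) by (simp add: add_divide_distrib)
    finally show "v \<le> u" by (simp add: u_def v_def)
  qed
  \<comment> \<open>This places the claimed bracket below \<open>Y - 2 * u * w\<close>, the one that
    the sieve provides.\<close>
  have "v * WQ \<le> u * w" using v WQ by (intro mult_mono) auto
  hence "\<delta> * \<theta> k * Y * (Y - 4 * u * w + 2 * v * WQ) \<le> \<delta> * \<theta> k * Y * (Y - 2 * u * w)"
    using \<theta>_pos Y_pos assms(20) by (intro mult_left_mono) auto
  also have "\<dots> = \<theta> k * Y * (\<delta> * Y - 2 * w * (real s - 1 + 2 * \<delta>))"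
    using assms(20) by (simp add: u_def field_simps)
  also have "\<dots> \<le> real (free_count \<beta> (S \<union> P))"
    using free_count_lower_bound[OF assms(8,9) finS _ P(1) _ disj D assms(20)] prS
    by (simp add: \<theta> XY w cardP)
  finally have main: "\<delta> * \<theta> k * Y * (Y - 4 * u * w + 2 * v * WQ) \<le> real (N_free q n \<beta> M)"
    by (simp add: N)
  moreover have "N_free q n \<beta> M > 0" if "Y > 4 * u * w - 2 * v * WQ"
  proof -
    have "0 < \<delta> * \<theta> k * Y * (Y - 4 * u * w + 2 * v * WQ)"
      using that \<theta>_pos Y_pos assms(20) by (intro mult_pos_pos) auto
    with main show ?thesis by linarith
  qed
  ultimately show ?thesis
    unfolding Y_def u_def v_def w_def WQ_def M_def by blast
qed

end
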